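(* Let $X$ and $Y$ be locally compact Hausdorff spaces, and let $T:C_0^+(X)\to C_0^+(Y)$ be a positive homogeneous order isomorphism. Then there exist a constant $\delta>0$, a unique bounded continuous function $\alpha:Y\to[\delta,\infty)$, and a unique homeomorphism $\tau:Y\to X$ such that $$T(f)(y)=\alpha(y)f(\tau(y))\qquad\text{for all } f\in C_0^+(X)\text{ and } y\in Y.$$ Conversely, if $\delta>0$ is a constant, $\alpha:Y\to[\delta,\infty)$ is a bounded continuous function and $\tau:Y\to X$ is a homeomorphism, then the mapping $T:C_0^+(X)\to C_0^+(Y)$ defined by $T(f)(y)=\alpha(y)f(\tau(y))$ ($f\in C_0^+(X)$, $y\in Y$) is a positive homogeneous order isomorphism.
   Context: For a locally compact Hausdorff space $X$, $C_0(X)$ denotes the Banach space of all real-valued continuous functions on $X$ vanishing at infinity (supremum norm), and $C_0^+(X)=\{f\in C_0(X): f(x)\ge 0 \text{ for all } x\in X\}$, ordered pointwise: $f\le g$ iff $f(x)\le g(x)$ for all $x\in X$. A mapping $T:C_0^+(X)\to C_0^+(Y)$ is an order isomorphism if it is bijective and $f\le g\iff T(f)\le T(g)$ for all $f,g\in C_0^+(X)$. It is positive homogeneous if $T(rf)=rT(f)$ for all real $r>0$ and $f\in C_0^+(X)$. No linearity or continuity of $T$ is assumed. *)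

theory Defs
  imports "HOL-Analysis.Analysis"
begin

text \<open>
  A space is an abstract topology, so the empty space is included. A function on \<open>X\<close> is
  represented by the HOL function that is \<open>undefined\<close> outside \<open>topspace X\<close> (the library's
  \<open>extensional\<close>), so that HOL equality is equality of functions on \<open>X\<close>. The norm of
  \<open>C\<^sub>0(X)\<close> plays no role in order isomorphisms or positive homogeneity and is not introduced.
\<close>

definition vanishes_at_infinity :: "'a topology \<Rightarrow> ('a \<Rightarrow> real) \<Rightarrow> bool" where
  "vanishes_at_infinity X f \<longleftrightarrow>
     (\<forall>\<epsilon>>0. compactin X {x \<in> topspace X. \<epsilon> \<le> \<bar>f x\<bar>})"

definition C0 :: "'a topology \<Rightarrow> ('a \<Rightarrow> real) set" where
  "C0 X = {f \<in> extensional (topspace X). continuous_map X euclideanreal f \<and> vanishes_at_infinity X f}"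

definition C0_plus :: "'a topology \<Rightarrow> ('a \<Rightarrow> real) set" where
  "C0_plus X = {f \<in> C0 X. \<forall>x \<in> topspace X. 0 \<le> f x}"

definition le_on :: "'a topology \<Rightarrow> ('a \<Rightarrow> real) \<Rightarrow> ('a \<Rightarrow> real) \<Rightarrow> bool" where
  "le_on X f g \<longleftrightarrow> (\<forall>x \<in> topspace X. f x \<le> g x)"

definition scale_on :: "'a topology \<Rightarrow> real \<Rightarrow> ('a \<Rightarrow> real) \<Rightarrow> ('a \<Rightarrow> real)" where
  "scale_on X r f = (\<lambda>x \<in> topspace X. r * f x)"

text \<open>
  The values of \<open>T\<close> outside \<open>C0_plus X\<close> are irrelevant to both predicates below.
\<close>

definition order_isomorphism ::
    "'a topology \<Rightarrow> 'b topology \<Rightarrow> (('a \<Rightarrow> real) \<Rightarrow> ('b \<Rightarrow> real)) \<Rightarrow> bool" where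
  "order_isomorphism X Y T \<longleftrightarrow>
     bij_betw T (C0_plus X) (C0_plus Y) \<and>
     (\<forall>f \<in> C0_plus X. \<forall>g \<in> C0_plus X. le_on X f g \<longleftrightarrow> le_on Y (T f) (T g))"

definition positive_homogeneous ::
    "'a topology \<Rightarrow> 'b topology \<Rightarrow> (('a \<Rightarrow> real) \<Rightarrow> ('b \<Rightarrow> real)) \<Rightarrow> bool" where
  "positive_homogeneous X Y T \<longleftrightarrow>
     (\<forall>r>0. \<forall>f \<in> C0_plus X. T (scale_on X r f) = scale_on Y r (T f))"

end

theory Submission
  imports Defs
begin

text \<open>
  A positive homogeneous order isomorphism \<open>T\<close> preserves binary maxima and minima, and summing
  \<open>2\<^sup>-\<^sup>n f\<^sub>n\<close> for \<open>f\<^sub>n \<le> 1\<close> with \<open>T f\<^sub>n\<close> large shows that \<open>T\<close> is bounded on \<open>{f. f \<le> 1}\<close>. Hence each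
  \<open>f \<mapsto> T f y\<close> is a nonzero bounded positive homogeneous lattice homomorphism, and these are exactly
  the positive multiples of point evaluations, even without additivity. This yields \<open>\<alpha>\<close> and \<open>\<tau>\<close>;
  applying the same to the inverse of \<open>T\<close> yields the inverse of \<open>\<tau>\<close> and the lower bound of \<open>\<alpha>\<close>.
\<close>

section \<open>Membership in \<open>C0_plus\<close> and its closure under lattice and cone
  operations\<close>

lemma C0_plusD:
  assumes "f \<in> C0_plus X"
  shows "f \<in> extensional (topspace X)" "continuous_map X euclideanreal f"
    "\<And>x. x \<in> topspace X \<Longrightarrow> 0 \<le> f x"
    "\<And>\<epsilon>. 0 < \<epsilon> \<Longrightarrow> compactin X {x \<in> topspace X. \<epsilon> \<le> f x}"
proof -
  show nonneg: "0 \<le> f x" if "x \<in> topspace X" for x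
    using assms that by (auto simp: C0_plus_def)
  show "compactin X {x \<in> topspace X. \<epsilon> \<le> f x}" if "0 < \<epsilon>" for \<epsilon>
  proof -
    have "{x \<in> topspace X. \<epsilon> \<le> f x} = {x \<in> topspace X. \<epsilon> \<le> \<bar>f x\<bar>}"
      using nonneg by auto
    then show ?thesis
      using assms that by (auto simp: C0_plus_def C0_def vanishes_at_infinity_def)
  qed
qed (use assms in \<open>auto simp: C0_plus_def C0_def\<close>)

lemma closedin_superlevel:
  "continuous_map X euclideanreal f \<Longrightarrow> closedin X {x \<in> topspace X. c \<le> f x}"
  by (auto simp: continuous_map_upper_lower_semicontinuous_le)

text \<open>Superlevel sets of a continuous function are closed, so lying inside some compact set
  already makes them compact. The restriction supplies extensionality.\<close>

lemma C0_plus_restrictI: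
  assumes "continuous_map X euclideanreal g" "\<And>x. x \<in> topspace X \<Longrightarrow> 0 \<le> g x"
    "\<And>\<epsilon>. 0 < \<epsilon> \<Longrightarrow> \<exists>K. compactin X K \<and> {x \<in> topspace X. \<epsilon> \<le> g x} \<subseteq> K"
  shows "restrict g (topspace X) \<in> C0_plus X"
proof -
  have "compactin X {x \<in> topspace X. \<epsilon> \<le> \<bar>restrict g (topspace X) x\<bar>}" if e: "0 < \<epsilon>" for \<epsilon>
  proof -
    have "{x \<in> topspace X. \<epsilon> \<le> \<bar>restrict g (topspace X) x\<bar>} = {x \<in> topspace X. \<epsilon> \<le> g x}"
      using assms(2) by auto
    moreover obtain K where K: "compactin X K" "{x \<in> topspace X. \<epsilon> \<le> g x} \<subseteq> K"
      using assms(3)[OF e] by blast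
    ultimately show ?thesis
      by (simp only: closed_compactin[OF K closedin_superlevel[OF assms(1)]])
  qed
  moreover have "continuous_map X euclideanreal (restrict g (topspace X))"
    using assms(1) by (rule continuous_map_eq) auto
  ultimately show ?thesis
    using assms(2) by (auto simp: C0_plus_def C0_def vanishes_at_infinity_def)
qed

lemma C0_plus_eqI:
  assumes "f \<in> C0_plus X" "g \<in> C0_plus X" "\<And>x. x \<in> topspace X \<Longrightarrow> f x = g x"
  shows "f = g"
  using assms by (meson C0_plusD(1) extensionalityI)

text \<open>If \<open>g \<le> C * f\<close>, then \<open>g \<ge> \<epsilon>\<close> forces
  \<open>f \<ge> \<epsilon> / C\<close>, so decay at infinity passes from \<open>f\<close> to
  \<open>g\<close>. Scaling, maxima, minima and truncated differences all reduce to this.\<close>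

lemma C0_plus_restrict_dominated:
  assumes "f \<in> C0_plus X" "continuous_map X euclideanreal g" "0 < C"
    "\<And>x. x \<in> topspace X \<Longrightarrow> 0 \<le> g x" "\<And>x. x \<in> topspace X \<Longrightarrow> g x \<le> C * f x"
  shows "restrict g (topspace X) \<in> C0_plus X"
proof (rule C0_plus_restrictI)
  fix \<epsilon> :: real assume "0 < \<epsilon>"
  then have "compactin X {x \<in> topspace X. \<epsilon> / C \<le> f x}"
    using assms(1,3) by (intro C0_plusD(4)) auto
  moreover have "{x \<in> topspace X. \<epsilon> \<le> g x} \<subseteq> {x \<in> topspace X. \<epsilon> / C \<le> f x}"
    using assms(3,5) by (auto simp: divide_le_eq mult.commute intro: order_trans)
  ultimately show "\<exists>K. compactin X K \<and> {x \<in> topspace X. \<epsilon> \<le> g x} \<subseteq> K" by blast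
qed (use assms in auto)

lemma scale_on_C0_plus:
  assumes "f \<in> C0_plus X" "0 < r"
  shows "scale_on X r f \<in> C0_plus X"
  unfolding scale_on_def
  by (rule C0_plus_restrict_dominated[OF assms(1) _ assms(2)])
    (use C0_plusD(2,3)[OF assms(1)] assms(2) in \<open>auto intro!: continuous_map_real_mult\<close>)

lemma add_C0_plus:
  assumes "f \<in> C0_plus X" "g \<in> C0_plus X"
  shows "(\<lambda>x\<in>topspace X. f x + g x) \<in> C0_plus X"
proof (rule C0_plus_restrictI)
  fix \<epsilon> :: real assume "0 < \<epsilon>"
  then have "compactin X ({x \<in> topspace X. \<epsilon>/2 \<le> f x} \<union> {x \<in> topspace X. \<epsilon>/2 \<le> g x})"
    using assms by (intro compactin_Un C0_plusD(4)) auto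
  moreover have "{x \<in> topspace X. \<epsilon> \<le> f x + g x} \<subseteq>
      {x \<in> topspace X. \<epsilon>/2 \<le> f x} \<union> {x \<in> topspace X. \<epsilon>/2 \<le> g x}"
    by auto
  ultimately show "\<exists>K. compactin X K \<and> {x \<in> topspace X. \<epsilon> \<le> f x + g x} \<subseteq> K" by blast
qed (use C0_plusD(2,3)[OF assms(1)] C0_plusD(2,3)[OF assms(2)] in \<open>auto intro!: continuous_map_add\<close>)

lemma max_C0_plus:
  assumes "f \<in> C0_plus X" "g \<in> C0_plus X"
  shows "(\<lambda>x\<in>topspace X. max (f x) (g x)) \<in> C0_plus X"
  by (rule C0_plus_restrict_dominated[OF add_C0_plus[OF assms], of _ 1])
    (use C0_plusD(2,3)[OF assms(1)] C0_plusD(2,3)[OF assms(2)] in \<open>auto simp: le_max_iff_disj intro!: continuous_map_real_max\<close>)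

lemma min_C0_plus:
  assumes "f \<in> C0_plus X" "g \<in> C0_plus X"
  shows "(\<lambda>x\<in>topspace X. min (f x) (g x)) \<in> C0_plus X"
  by (rule C0_plus_restrict_dominated[OF assms(1), of _ 1])
    (use C0_plusD(2,3)[OF assms(1)] C0_plusD(2,3)[OF assms(2)] in \<open>auto intro!: continuous_map_real_min\<close>)

lemma diff_C0_plus:
  assumes "f \<in> C0_plus X" "g \<in> C0_plus X"
  shows "(\<lambda>x\<in>topspace X. max (f x - g x) 0) \<in> C0_plus X"
  by (rule C0_plus_restrict_dominated[OF assms(1), of _ 1])
    (use C0_plusD(2,3)[OF assms(1)] C0_plusD(2,3)[OF assms(2)] in \<open>auto intro!: continuous_map_real_max continuous_map_diff\<close>)

lemma zero_C0_plus: "(\<lambda>x\<in>topspace X. 0) \<in> C0_plus X"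
  by (rule C0_plus_restrictI) (auto intro: exI[of _ "{}"])

section \<open>Bounds, uniform limits and series\<close>

text \<open>Values of at least 1 are taken on a compact set, whose image is bounded; all other
  values are below 1.\<close>

lemma C0_plus_bounded:
  assumes "f \<in> C0_plus X"
  obtains B where "0 < B" "\<And>x. x \<in> topspace X \<Longrightarrow> f x \<le> B"
proof -
  have "compactin euclideanreal (f ` {x \<in> topspace X. 1 \<le> f x})"
    using assms by (intro image_compactin[of X] C0_plusD) auto
  then have "bounded (f ` {x \<in> topspace X. 1 \<le> f x})"
    by (simp add: compact_imp_bounded)
  then obtain B where "\<And>x. x \<in> topspace X \<Longrightarrow> 1 \<le> f x \<Longrightarrow> \<bar>f x\<bar> \<le> B"
    by (auto simp: bounded_iff)
  then have "f x \<le> max B 1" if "x \<in> topspace X" for x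
    using that by (cases "1 \<le> f x") fastforce+
  then show ?thesis by (intro that[of "max B 1"]) auto
qed

text \<open>Once \<open>S n\<close> is within \<open>\<epsilon>/2\<close> of \<open>F\<close>, the
  set where \<open>F \<ge> \<epsilon>\<close> lies in the compact set where
  \<open>S n \<ge> \<epsilon>/2\<close>.\<close>

lemma C0_plus_uniform_limit:
  assumes S: "\<And>n. S n \<in> C0_plus X" and lim: "uniform_limit (topspace X) S F sequentially"
  shows "restrict F (topspace X) \<in> C0_plus X"
proof (rule C0_plus_restrictI)
  have close: "\<exists>n. \<forall>x\<in>topspace X. \<bar>S n x - F x\<bar> < e" if "0 < e" for e
    using uniform_limitD[OF lim that] by (auto simp: dist_real_def eventually_sequentially)
  show "continuous_map X euclideanreal F"
  proof -
    \<comment> \<open>The uniform limit theorem is phrased for a metric target; on the reals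
      \<open>Met_TC.mtopology\<close> is the Euclidean topology.\<close>
    have "\<forall>\<^sub>F n in sequentially. continuous_map X Met_TC.mtopology (S n)"
      using C0_plusD(2)[OF S] by simp
    moreover have "\<forall>\<^sub>F n in sequentially. \<forall>x\<in>topspace X. F x \<in> UNIV \<and> dist (S n x) (F x) < e"
      if "0 < e" for e
      using uniform_limitD[OF lim that] by simp
    ultimately have "continuous_map X Met_TC.mtopology F"
      by (rule Met_TC.continuous_map_uniform_limit) simp_all
    then show ?thesis by simp
  qed
  show "0 \<le> F x" if x: "x \<in> topspace X" for x
  proof (rule field_le_epsilon)
    fix e :: real assume "0 < e"
    then obtain n where "\<bar>S n x - F x\<bar> < e" using close x by blast
    with C0_plusD(3)[OF S x, of n] show "0 \<le> F x + e" by linarith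
  qed
  fix \<epsilon> :: real assume "0 < \<epsilon>"
  then obtain n where n: "\<forall>x\<in>topspace X. \<bar>S n x - F x\<bar> < \<epsilon>/2" using close[of "\<epsilon>/2"] by auto
  have "{x \<in> topspace X. \<epsilon> \<le> F x} \<subseteq> {x \<in> topspace X. \<epsilon>/2 \<le> S n x}"
    using n by (auto simp: abs_less_iff) (smt (verit) field_sum_of_halves)
  then show "\<exists>K. compactin X K \<and> {x \<in> topspace X. \<epsilon> \<le> F x} \<subseteq> K"
    using C0_plusD(4)[OF S, of "\<epsilon>/2" n] \<open>0 < \<epsilon>\<close> by auto
qed

text \<open>\<open>F\<close> is the sum of the functions \<open>(1/2)^n * f n\<close>, which
  converges uniformly by the Weierstrass test. As all terms are nonnegative, the sum dominates each
  of them.\<close>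

lemma C0_plus_weighted_series:
  fixes f :: "nat \<Rightarrow> 'a \<Rightarrow> real"
  assumes f: "\<And>n. f n \<in> C0_plus X" and le1: "\<And>n x. x \<in> topspace X \<Longrightarrow> f n x \<le> 1"
  obtains F where "F \<in> C0_plus X"
    "\<And>n x. x \<in> topspace X \<Longrightarrow> (1/2)^n * f n x \<le> F x"
proof -
  let ?g = "\<lambda>n x. (1/2)^n * f n x"
  have bd: "norm (?g n x) \<le> (1/2)^n" if "x \<in> topspace X" for n x
    using le1[OF that] C0_plusD(3)[OF f that] by (simp add: abs_mult mult_left_le)
  have sm: "summable (\<lambda>n. (1/2::real)^n)" by (simp add: summable_geometric)
  have partial: "(\<lambda>x\<in>topspace X. \<Sum>i<n. ?g i x) \<in> C0_plus X" for n
  proof (induction n)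
    case 0
    show ?case unfolding lessThan_0 sum.empty by (rule zero_C0_plus)
  next
    case (Suc n)
    have "(\<lambda>x\<in>topspace X. \<Sum>i<Suc n. ?g i x) =
      (\<lambda>x\<in>topspace X. (\<lambda>x\<in>topspace X. \<Sum>i<n. ?g i x) x + scale_on X ((1/2)^n) (f n) x)"
      by (auto simp: scale_on_def restrict_def fun_eq_iff)
    moreover have "0 < (1/2::real)^n" by simp
    ultimately show ?case
      by (simp only: add_C0_plus[OF Suc scale_on_C0_plus[OF f]])
  qed
  have "uniform_limit (topspace X) (\<lambda>n x. \<Sum>i<n. ?g i x) (\<lambda>x. \<Sum>i. ?g i x) sequentially"
    by (rule Weierstrass_m_test[OF bd sm])
  then have "uniform_limit (topspace X) (\<lambda>n. \<lambda>x\<in>topspace X. \<Sum>i<n. ?g i x)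
      (\<lambda>x. \<Sum>i. ?g i x) sequentially"
    by (simp cong: uniform_limit_cong')
  then have "(\<lambda>x\<in>topspace X. \<Sum>i. ?g i x) \<in> C0_plus X"
    by (rule C0_plus_uniform_limit[OF partial])
  moreover have "?g n x \<le> (\<Sum>i. ?g i x)" if x: "x \<in> topspace X" for n x
  proof -
    have "summable (\<lambda>i. ?g i x)"
      by (rule summable_comparison_test[OF _ sm]) (use bd[OF x] in auto)
    then have "sum (\<lambda>i. ?g i x) {n} \<le> (\<Sum>i. ?g i x)"
      by (rule sum_le_suminf) (use C0_plusD(3)[OF f x] in auto)
    then show ?thesis by simp
  qed
  ultimately show ?thesis by (intro that[of "\<lambda>x\<in>topspace X. \<Sum>i. ?g i x"]) auto
qed

section \<open>Urysohn functions and separation of points\<close>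

text \<open>Complete regularity gives \<open>h\<close> with \<open>h x = 0\<close> and
  \<open>h = 1\<close> off \<open>U \<inter> V\<close>, where the open set \<open>V\<close> lies in
  a compact \<open>K\<close>. Then \<open>1 - h\<close> vanishes outside \<open>U\<close> and
  outside \<open>K\<close>, hence at infinity.\<close>

lemma C0_plus_Urysohn:
  assumes "locally_compact_space X" "Hausdorff_space X" "openin X U" "x \<in> U"
  shows "\<exists>f\<in>C0_plus X. f x = 1 \<and> (\<forall>z\<in>topspace X. f z \<le> 1) \<and> (\<forall>z\<in>topspace X - U. f z = 0)"
proof -
  have x: "x \<in> topspace X" using assms(3,4) openin_subset by blast
  obtain V K where V: "openin X V" "compactin X K" "x \<in> V" "V \<subseteq> K"
    using assms(1) x unfolding locally_compact_space_def by blast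
  have "completely_regular_space X"
    using assms(1,2) locally_compact_Hausdorff_imp_regular_space
      locally_compact_regular_imp_completely_regular_space by blast
  moreover have "closedin X (topspace X - U \<inter> V)" using V assms by blast
  ultimately obtain h :: "'a \<Rightarrow> real" where h: "continuous_map X (top_of_set {0..1}) h" "h x = 0"
      "h ` (topspace X - U \<inter> V) \<subseteq> {1}"
    unfolding completely_regular_space_def using V x assms(4) by (metis DiffD2 DiffI IntI)
  have hc: "continuous_map X euclideanreal h" and h01: "\<And>z. z \<in> topspace X \<Longrightarrow> 0 \<le> h z \<and> h z \<le> 1"
    using h(1) by (auto simp: continuous_map_in_subtopology)
  have "(\<lambda>z\<in>topspace X. 1 - h z) \<in> C0_plus X"
  proof (rule C0_plus_restrictI)
    fix \<epsilon> :: real assume "0 < \<epsilon>"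
    then have "{z \<in> topspace X. \<epsilon> \<le> 1 - h z} \<subseteq> K" using h(3) V(4) by fastforce
    then show "\<exists>K. compactin X K \<and> {z \<in> topspace X. \<epsilon> \<le> 1 - h z} \<subseteq> K" using V by blast
  qed (use hc h01 in \<open>auto intro!: continuous_map_diff\<close>)
  then show ?thesis
    by (rule bexI[rotated]) (use h h01 x in \<open>auto simp: image_subset_iff\<close>)
qed

lemma C0_plus_separates:
  assumes "locally_compact_space X" "Hausdorff_space X" "x \<in> topspace X" "z \<in> topspace X" "z \<noteq> x"
  shows "\<exists>f\<in>C0_plus X. f x = 1 \<and> f z = 0"
proof -
  have "openin X (topspace X - {z})"
    using assms(2,4) by (meson Hausdorff_imp_t1_space closedin_t1_singleton openin_diff openin_topspace)
  moreover have "x \<in> topspace X - {z}" using assms(3,5) by simp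
  ultimately show ?thesis
    using C0_plus_Urysohn[OF assms(1,2), of "topspace X - {z}" x] assms(4) by auto
qed

section \<open>Lattice functionals as multiples of point evaluations\<close>

text \<open>The point \<open>x\<close> representing \<open>\<phi>\<close> comes from the finite intersection property of the compact sets
  \<open>{f \<ge> c}\<close>, where \<open>\<phi> f = 1\<close> and \<open>c = 1/(2M)\<close>; it satisfies \<open>\<phi> f \<le> 2 M f x\<close>. If then \<open>h x = k x\<close>,
  the inequality \<open>h \<le> max ((1 + e) k) ((1 + 1/e) (h - k)\<^sup>+)\<close>, whose last term is killed by \<open>\<phi>\<close>,
  gives \<open>\<phi> h \<le> \<phi> k\<close>, so that additivity of \<open>\<phi>\<close> is not needed.\<close>
lemma lattice_functional_representation:
  fixes \<phi> :: "('a \<Rightarrow> real) \<Rightarrow> real"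
  assumes max: "\<And>f g. f \<in> C0_plus X \<Longrightarrow> g \<in> C0_plus X \<Longrightarrow>
      \<phi> (\<lambda>x\<in>topspace X. max (f x) (g x)) = max (\<phi> f) (\<phi> g)"
    and min: "\<And>f g. f \<in> C0_plus X \<Longrightarrow> g \<in> C0_plus X \<Longrightarrow>
      \<phi> (\<lambda>x\<in>topspace X. min (f x) (g x)) = min (\<phi> f) (\<phi> g)"
    and hom: "\<And>f r. f \<in> C0_plus X \<Longrightarrow> 0 < r \<Longrightarrow> \<phi> (scale_on X r f) = r * \<phi> f"
    and nonneg: "\<And>f. f \<in> C0_plus X \<Longrightarrow> 0 \<le> \<phi> f"
    and bdd: "\<And>f. f \<in> C0_plus X \<Longrightarrow> (\<And>x. x \<in> topspace X \<Longrightarrow> f x \<le> 1) \<Longrightarrow> \<phi> f \<le> M"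
    and nonzero: "g \<in> C0_plus X" "\<phi> g \<noteq> 0"
  obtains x a where "x \<in> topspace X" "0 < a" "\<And>f. f \<in> C0_plus X \<Longrightarrow> \<phi> f = a * f x"
proof -
  \<comment> \<open>The sign of \<open>M\<close> is unknown; this choice makes \<open>N\<close>
    positive and larger than \<open>M\<close>.\<close>
  define N where "N = 2 * (\<bar>M\<bar> + 1)"
  define c where "c = 1 / N"
  define S where "S f = {x \<in> topspace X. c \<le> f x}" for f :: "'a \<Rightarrow> real"
  define P where "P = {f \<in> C0_plus X. \<phi> f = 1}"
  have N: "0 < N" and c: "0 < c" by (auto simp: N_def c_def)
  \<comment> \<open>If \<open>f\<close> stayed below \<open>1/N\<close>, then
    \<open>N f \<le> 1\<close> and the bound would give
    \<open>N = \<phi> (N f) \<le> M\<close>.\<close>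
  have S_nonempty: "S f \<noteq> {}" if "f \<in> P" for f
  proof
    assume "S f = {}"
    have f: "f \<in> C0_plus X" "\<phi> f = 1" using that by (auto simp: P_def)
    have "scale_on X N f x \<le> 1" if "x \<in> topspace X" for x
    proof -
      have "f x < 1 / N" using \<open>S f = {}\<close> that by (auto simp: S_def c_def)
      then show ?thesis using N that by (simp add: scale_on_def field_simps)
    qed
    then have "\<phi> (scale_on X N f) \<le> M" by (intro bdd scale_on_C0_plus f N)
    then show False using hom[OF f(1) N] f(2) by (auto simp: N_def)
  qed
  have normalize: "scale_on X (1 / \<phi> f) f \<in> P" if "f \<in> C0_plus X" "0 < \<phi> f" for f
    using that hom[OF that(1), of "1 / \<phi> f"] scale_on_C0_plus[OF that(1), of "1 / \<phi> f"]
    by (auto simp: P_def)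
  define f0 where "f0 = scale_on X (1 / \<phi> g) g"
  have f0: "f0 \<in> P" using normalize[OF nonzero(1)] nonzero nonneg[OF nonzero(1)] by (simp add: f0_def)
  \<comment> \<open>\<open>P\<close> is closed under minima because \<open>\<phi>\<close> preserves
    them, and \<open>S\<close> turns minima into intersections; so each finite intersection contains
    some nonempty \<open>S h\<close>.\<close>
  have fin: "\<exists>h\<in>P. S h \<subseteq> S f0 \<inter> \<Inter>\<F>" if "finite \<F>" "\<F> \<subseteq> S ` P" for \<F>
    using that
  proof (induction \<F>)
    case empty
    then show ?case using f0 by auto
  next
    case (insert A \<F>)
    then obtain h k where h: "h \<in> P" "S h \<subseteq> S f0 \<inter> \<Inter>\<F>" and k: "k \<in> P" "A = S k" by auto
    have "(\<lambda>x\<in>topspace X. min (h x) (k x)) \<in> P"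
      using h(1) k(1) min[of h k] min_C0_plus[of h X k] by (simp add: P_def)
    moreover have "S (\<lambda>x\<in>topspace X. min (h x) (k x)) = S h \<inter> S k"
      by (auto simp: S_def)
    ultimately show ?case using h(2) k(2) by blast
  qed
  have "compactin X (S f0)"
    unfolding S_def using f0 c by (intro C0_plusD(4)) (auto simp: P_def)
  moreover have "\<forall>A\<in>S ` P. closedin X A"
    unfolding S_def P_def by (auto intro: closedin_superlevel C0_plusD(2))
  moreover have "\<forall>\<F>. finite \<F> \<and> \<F> \<subseteq> S ` P \<longrightarrow> S f0 \<inter> \<Inter>\<F> \<noteq> {}"
    using fin S_nonempty by (metis subset_empty)
  ultimately have "S f0 \<inter> \<Inter>(S ` P) \<noteq> {}"
    unfolding compactin_fip by blast
  then obtain x where "x \<in> S f0" and x_in: "\<And>f. f \<in> P \<Longrightarrow> x \<in> S f" by auto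
  then have x: "x \<in> topspace X" by (simp add: S_def)
  \<comment> \<open>When \<open>\<phi> f > 0\<close>, the normalized \<open>f / \<phi> f\<close>
    lies in \<open>P\<close>, so its value at \<open>x\<close> is at least
    \<open>1/N\<close>.\<close>
  have dom: "\<phi> f \<le> N * f x" if f: "f \<in> C0_plus X" for f
  proof (cases "0 < \<phi> f")
    case True
    then have "c \<le> f x / \<phi> f"
      using x_in[OF normalize[OF f True]] x by (simp add: S_def scale_on_def)
    then show ?thesis using True N by (simp add: c_def field_simps)
  next
    case False
    have "0 \<le> N * f x" using N C0_plusD(3)[OF f x] by simp
    then show ?thesis using False by linarith
  qed
  have mono: "\<phi> f \<le> \<phi> h"
    if "f \<in> C0_plus X" "h \<in> C0_plus X" "\<And>x. x \<in> topspace X \<Longrightarrow> f x \<le> h x" for f h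
  proof -
    have "(\<lambda>x\<in>topspace X. max (f x) (h x)) = h"
      by (rule C0_plus_eqI[OF max_C0_plus]) (use that in auto)
    then show ?thesis using max[OF that(1,2)] by simp
  qed
  have le: "\<phi> h \<le> \<phi> k" if h: "h \<in> C0_plus X" and k: "k \<in> C0_plus X" and "h x = k x" for h k
  proof -
    define d where "d = (\<lambda>z\<in>topspace X. max (h z - k z) 0)"
    have d: "d \<in> C0_plus X" unfolding d_def by (rule diff_C0_plus[OF h k])
    have "\<phi> d = 0" using dom[OF d] nonneg[OF d] x \<open>h x = k x\<close> by (simp add: d_def)
    have "\<phi> h \<le> (1 + e) * \<phi> k" if e: "0 < e" for e
    proof -
      have e': "0 < 1 + e" "0 < 1 + 1 / e" using e by (auto intro: add_pos_pos)
      have ck: "scale_on X (1 + e) k \<in> C0_plus X" and cd: "scale_on X (1 + 1 / e) d \<in> C0_plus X"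
        using scale_on_C0_plus k d e' by blast+
      have "h z \<le> max ((1 + e) * k z) ((1 + 1 / e) * max (h z - k z) 0)" if z: "z \<in> topspace X" for z
      proof (cases "h z \<le> (1 + e) * k z")
        \<comment> \<open>Here \<open>e k z < h z - k z\<close>, so \<open>k z\<close> is below
          \<open>(h z - k z) / e\<close>; adding \<open>h z - k z\<close> bounds \<open>h z\<close>
          by the second term of the maximum.\<close>
        case False
        then have *: "e * k z < h z - k z" by (simp add: algebra_simps)
        then have "k z < (h z - k z) / e" using e by (simp add: field_simps)
        then have "h z \<le> (1 + 1 / e) * (h z - k z)" by (simp add: distrib_right)
        moreover have "0 \<le> e * k z" using e C0_plusD(3)[OF k z] by simp
        ultimately show ?thesis using * by (simp add: max_def)
      qed auto
      then have "\<phi> h \<le> \<phi> (\<lambda>z\<in>topspace X. max (scale_on X (1 + e) k z) (scale_on X (1 + 1 / e) d z))"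
        by (intro mono[OF h max_C0_plus[OF ck cd]]) (auto simp: scale_on_def d_def)
      also have "\<dots> = max ((1 + e) * \<phi> k) ((1 + 1 / e) * \<phi> d)"
        by (simp only: max[OF ck cd] hom[OF k e'(1)] hom[OF d e'(2)])
      also have "\<dots> = (1 + e) * \<phi> k"
        using nonneg[OF k] e by (simp add: \<open>\<phi> d = 0\<close>)
      finally show ?thesis .
    qed
    note bound = this
    show ?thesis
    proof (rule field_le_mult_one_interval)
      fix z :: real assume z: "0 < z" "z < 1"
      \<comment> \<open>The substitution \<open>e = 1/z - 1\<close> turns the factor
        \<open>1 + e\<close> into \<open>1/z\<close>.\<close>
      have "\<phi> h \<le> (1 + (1 / z - 1)) * \<phi> k" using z by (intro bound) (simp add: field_simps)
      then show "z * \<phi> h \<le> \<phi> k" using z by (simp add: field_simps)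
    qed
  qed
  have "\<phi> f0 = 1" "f0 \<in> C0_plus X" using f0 by (auto simp: P_def)
  have f0x: "0 < f0 x"
    using \<open>x \<in> S f0\<close> c by (simp add: S_def)
  show ?thesis
  \<comment> \<open>The factor is forced by \<open>\<phi> f0 = 1\<close>. For
    \<open>f x > 0\<close>, the functions \<open>f0 x * f\<close> and \<open>f x * f0\<close> agree
    at \<open>x\<close>, so \<open>le\<close> in both directions makes their
    \<open>\<phi>\<close>-values equal.\<close>
  proof (rule that[OF x, of "1 / f0 x"])
    fix f assume f: "f \<in> C0_plus X"
    show "\<phi> f = 1 / f0 x * f x"
    proof (cases "f x = 0")
      case True
      then show ?thesis using dom[OF f] nonneg[OF f] by simp
    next
      case False
      then have fx: "0 < f x" using C0_plusD(3)[OF f x] by simp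
      have sf: "scale_on X (f0 x) f \<in> C0_plus X" and s0: "scale_on X (f x) f0 \<in> C0_plus X"
        using scale_on_C0_plus f \<open>f0 \<in> C0_plus X\<close> f0x fx by blast+
      have "scale_on X (f0 x) f x = scale_on X (f x) f0 x" using x by (simp add: scale_on_def)
      then have "\<phi> (scale_on X (f0 x) f) = \<phi> (scale_on X (f x) f0)"
        using le[OF sf s0] le[OF s0 sf] by simp
      then show ?thesis
        using f0x by (simp add: hom f \<open>f0 \<in> C0_plus X\<close> fx \<open>\<phi> f0 = 1\<close> field_simps)
    qed
  qed (use f0x in simp)
qed

section \<open>Order isomorphisms: lattice operations, inverses and boundedness\<close>

lemma order_isomorphism_in:
  "order_isomorphism X Y T \<Longrightarrow> f \<in> C0_plus X \<Longrightarrow> T f \<in> C0_plus Y"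
  by (auto simp: order_isomorphism_def dest: bij_betwE)

lemma order_isomorphism_surj:
  assumes "order_isomorphism X Y T" "g \<in> C0_plus Y"
  obtains f where "f \<in> C0_plus X" "T f = g"
proof -
  have "g \<in> T ` C0_plus X" using assms by (simp add: order_isomorphism_def bij_betw_def)
  then show ?thesis using that by blast
qed

lemma order_isomorphism_le_iff:
  assumes "order_isomorphism X Y T" "f \<in> C0_plus X" "g \<in> C0_plus X"
  shows "(\<forall>y\<in>topspace Y. T f y \<le> T g y) \<longleftrightarrow> (\<forall>x\<in>topspace X. f x \<le> g x)"
  using assms by (simp add: order_isomorphism_def le_on_def)

text \<open>The maximum is the least upper bound on both sides. By surjectivity the pointwise
  maximum of \<open>T f\<close> and \<open>T g\<close> is some \<open>T k\<close>; then
  \<open>k\<close> dominates \<open>f\<close> and \<open>g\<close>, hence their maximum, and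
  \<open>T\<close> carries this back.\<close>

lemma order_isomorphism_max:
  assumes T: "order_isomorphism X Y T" and f: "f \<in> C0_plus X" and g: "g \<in> C0_plus X"
    and y: "y \<in> topspace Y"
  shows "T (\<lambda>x\<in>topspace X. max (f x) (g x)) y = max (T f y) (T g y)"
proof -
  let ?s = "\<lambda>x\<in>topspace X. max (f x) (g x)" and ?m = "\<lambda>y\<in>topspace Y. max (T f y) (T g y)"
  note s = max_C0_plus[OF f g]
  have "?m \<in> C0_plus Y" by (intro max_C0_plus order_isomorphism_in[OF T] f g)
  then obtain k where k: "k \<in> C0_plus X" "T k = ?m" by (rule order_isomorphism_surj[OF T])
  have "\<forall>x\<in>topspace X. f x \<le> k x" "\<forall>x\<in>topspace X. g x \<le> k x"
    by (simp_all add: order_isomorphism_le_iff[OF T _ k(1), symmetric] f g k(2))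
  then have "\<forall>y\<in>topspace Y. T ?s y \<le> ?m y"
    unfolding k(2)[symmetric] order_isomorphism_le_iff[OF T s k(1)] by simp
  moreover have "\<forall>y\<in>topspace Y. T f y \<le> T ?s y" "\<forall>y\<in>topspace Y. T g y \<le> T ?s y"
    unfolding order_isomorphism_le_iff[OF T f s] order_isomorphism_le_iff[OF T g s] by simp_all
  ultimately show ?thesis using y by (simp add: antisym)
qed

text \<open>The order dual of \<open>order_isomorphism_max\<close>, with greatest lower
  bounds.\<close>

lemma order_isomorphism_min:
  assumes T: "order_isomorphism X Y T" and f: "f \<in> C0_plus X" and g: "g \<in> C0_plus X"
    and y: "y \<in> topspace Y"
  shows "T (\<lambda>x\<in>topspace X. min (f x) (g x)) y = min (T f y) (T g y)"
proof -
  let ?s = "\<lambda>x\<in>topspace X. min (f x) (g x)" and ?m = "\<lambda>y\<in>topspace Y. min (T f y) (T g y)"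
  note s = min_C0_plus[OF f g]
  have "?m \<in> C0_plus Y" by (intro min_C0_plus order_isomorphism_in[OF T] f g)
  then obtain k where k: "k \<in> C0_plus X" "T k = ?m" by (rule order_isomorphism_surj[OF T])
  have "\<forall>x\<in>topspace X. k x \<le> f x" "\<forall>x\<in>topspace X. k x \<le> g x"
    by (simp_all add: order_isomorphism_le_iff[OF T k(1), symmetric] f g k(2))
  then have "\<forall>y\<in>topspace Y. ?m y \<le> T ?s y"
    unfolding k(2)[symmetric] order_isomorphism_le_iff[OF T k(1) s] by simp
  moreover have "\<forall>y\<in>topspace Y. T ?s y \<le> T f y" "\<forall>y\<in>topspace Y. T ?s y \<le> T g y"
    unfolding order_isomorphism_le_iff[OF T s f] order_isomorphism_le_iff[OF T s g] by simp_all
  ultimately show ?thesis using y by (simp add: antisym)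
qed

lemma positive_homogeneous_apply:
  assumes "positive_homogeneous X Y T" "f \<in> C0_plus X" "0 < r" "y \<in> topspace Y"
  shows "T (scale_on X r f) y = r * T f y"
  using assms unfolding positive_homogeneous_def by (simp add: scale_on_def)

text \<open>Together with \<open>positive_homogeneous_inv_into\<close>, this makes the pointwise
  representation available for the inverse of \<open>T\<close>.\<close>

lemma order_isomorphism_inv_into:
  assumes T: "order_isomorphism X Y T"
  shows "order_isomorphism Y X (inv_into (C0_plus X) T)"
proof -
  let ?S = "inv_into (C0_plus X) T"
  have bij: "bij_betw T (C0_plus X) (C0_plus Y)" using T by (simp add: order_isomorphism_def)
  have S: "bij_betw ?S (C0_plus Y) (C0_plus X)" by (rule bij_betw_inv_into[OF bij])
  have "le_on Y f g \<longleftrightarrow> le_on X (?S f) (?S g)" if "f \<in> C0_plus Y" "g \<in> C0_plus Y" for f g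
  proof -
    have "?S f \<in> C0_plus X" "?S g \<in> C0_plus X" using S that by (auto dest: bij_betwE)
    then have "le_on X (?S f) (?S g) \<longleftrightarrow> le_on Y (T (?S f)) (T (?S g))"
      using T by (simp add: order_isomorphism_def)
    then show ?thesis using that by (simp add: bij_betw_inv_into_right[OF bij])
  qed
  then show ?thesis using S by (simp add: order_isomorphism_def)
qed

lemma positive_homogeneous_inv_into:
  assumes T: "order_isomorphism X Y T" and hom: "positive_homogeneous X Y T"
  shows "positive_homogeneous Y X (inv_into (C0_plus X) T)"
  unfolding positive_homogeneous_def
proof (intro allI impI ballI)
  fix r :: real and g assume r: "0 < r" and "g \<in> C0_plus Y"
  have bij: "bij_betw T (C0_plus X) (C0_plus Y)" using T by (simp add: order_isomorphism_def)
  obtain f where f: "f \<in> C0_plus X" "T f = g"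
    by (rule order_isomorphism_surj[OF T \<open>g \<in> C0_plus Y\<close>])
  have scale: "scale_on Y r (T f) = T (scale_on X r f)"
    using hom f(1) r by (simp add: positive_homogeneous_def)
  show "inv_into (C0_plus X) T (scale_on Y r g) = scale_on X r (inv_into (C0_plus X) T g)"
    unfolding f(2)[symmetric]
    by (simp add: scale bij_betw_inv_into_left[OF bij] scale_on_C0_plus r f(1))
qed

lemma order_isomorphism_bounded:
  assumes T: "order_isomorphism X Y T" and hom: "positive_homogeneous X Y T"
  shows "\<exists>M>0. \<forall>f\<in>C0_plus X. (\<forall>x\<in>topspace X. f x \<le> 1) \<longrightarrow> (\<forall>y\<in>topspace Y. T f y \<le> M)"
    (is "\<exists>M>0. ?P M")
proof (rule ccontr)
  assume "\<not> (\<exists>M>0. ?P M)"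
  \<comment> \<open>The growth \<open>4 ^ n\<close> is chosen to beat the weights
    \<open>(1/2)^n\<close> of the series: it forces \<open>T F (y n) > 2 ^ n\<close> for every
    \<open>n\<close>, while \<open>T F\<close> is bounded.\<close>
  then have "\<exists>f y. f \<in> C0_plus X \<and> (\<forall>x\<in>topspace X. f x \<le> 1) \<and> y \<in> topspace Y \<and> 4 ^ n < T f y"
    for n :: nat
    by (meson not_le zero_less_numeral zero_less_power)
  then obtain f y where f: "\<And>n. f n \<in> C0_plus X" "\<And>n x. x \<in> topspace X \<Longrightarrow> f n x \<le> 1"
    and y: "\<And>n. y n \<in> topspace Y" "\<And>n::nat. 4 ^ n < T (f n) (y n)"
    by metis
  obtain F where F: "F \<in> C0_plus X"
      "\<And>n x. x \<in> topspace X \<Longrightarrow> (1/2)^n * f n x \<le> F x"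
    by (rule C0_plus_weighted_series[of f X]) (use f in auto)
  obtain B where B: "0 < B" "\<And>y. y \<in> topspace Y \<Longrightarrow> T F y \<le> B"
    by (rule C0_plus_bounded[OF order_isomorphism_in[OF T F(1)]]) blast
  obtain n where n: "B < 2 ^ n" using real_arch_pow[of 2 B] by auto
  have pos: "0 < (1/2::real)^n" by simp
  have "T (scale_on X ((1/2)^n) (f n)) (y n) \<le> T F (y n)"
    using order_isomorphism_le_iff[OF T scale_on_C0_plus[OF f(1) pos] F(1), of n] F(2) y(1)
    by (simp add: scale_on_def)
  then have "(1/2)^n * T (f n) (y n) \<le> B"
    using B(2)[OF y(1)[of n]] by (simp add: positive_homogeneous_apply[OF hom f(1) pos y(1)])
  moreover have "(1/2)^n * 4^n < (1/2)^n * T (f n) (y n)" using y(2)[of n] by simp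
  moreover have "(1/2)^n * 4^n = (2::real)^n" by (simp flip: power_mult_distrib)
  ultimately show False using n by simp
qed

section \<open>The pointwise representation and its regularity\<close>

text \<open>For each \<open>y\<close> the functional \<open>T f y\<close> of \<open>f\<close> is
  represented by a point and a positive factor; choice collects these into \<open>\<tau>\<close> and
  \<open>\<alpha>\<close>, with no continuity claimed yet.\<close>

lemma order_isomorphism_pointwise:
  assumes X: "locally_compact_space X" "Hausdorff_space X"
    and Y: "locally_compact_space Y" "Hausdorff_space Y"
    and T: "order_isomorphism X Y T" and hom: "positive_homogeneous X Y T"
  obtains M :: real and \<alpha> \<tau> where "0 < M"
    "\<And>y. y \<in> topspace Y \<Longrightarrow> \<tau> y \<in> topspace X" "\<And>y. y \<in> topspace Y \<Longrightarrow> 0 < \<alpha> y"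
    "\<And>y. y \<in> topspace Y \<Longrightarrow> \<alpha> y \<le> M"
    "\<And>f y. f \<in> C0_plus X \<Longrightarrow> y \<in> topspace Y \<Longrightarrow> T f y = \<alpha> y * f (\<tau> y)"
proof -
  obtain M where M: "0 < M"
    "\<And>f y. f \<in> C0_plus X \<Longrightarrow> (\<And>x. x \<in> topspace X \<Longrightarrow> f x \<le> 1) \<Longrightarrow> y \<in> topspace Y \<Longrightarrow> T f y \<le> M"
    using order_isomorphism_bounded[OF T hom] by blast
  have "\<exists>x a. x \<in> topspace X \<and> 0 < a \<and> (\<forall>f\<in>C0_plus X. T f y = a * f x)"
    if y: "y \<in> topspace Y" for y
  proof -
    \<comment> \<open>A preimage of a function with value 1 at \<open>y\<close> shows that the
      functional is nonzero.\<close>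
    obtain h where h: "h \<in> C0_plus Y" "h y = 1"
      using C0_plus_Urysohn[OF Y openin_topspace y] by blast
    obtain g where g: "g \<in> C0_plus X" "T g = h" by (rule order_isomorphism_surj[OF T h(1)])
    show ?thesis
    proof (rule lattice_functional_representation[of X "\<lambda>f. T f y" M g])
      show "T (scale_on X r f) y = r * T f y" if "f \<in> C0_plus X" "0 < r" for f r
        by (rule positive_homogeneous_apply[OF hom that y])
      show "0 \<le> T f y" if "f \<in> C0_plus X" for f
        by (rule C0_plusD(3)[OF order_isomorphism_in[OF T that] y])
    qed (use order_isomorphism_max[OF T _ _ y] order_isomorphism_min[OF T _ _ y] M(2) y g h in auto)
  qed
  then have "\<forall>y\<in>topspace Y. \<exists>x a. x \<in> topspace X \<and> 0 < a \<and> (\<forall>f\<in>C0_plus X. T f y = a * f x)"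
    by blast
  from bchoice[OF this] obtain \<tau> where
    "\<forall>y\<in>topspace Y. \<exists>a. \<tau> y \<in> topspace X \<and> 0 < a \<and> (\<forall>f\<in>C0_plus X. T f y = a * f (\<tau> y))" ..
  from bchoice[OF this] obtain \<alpha> where
    "\<forall>y\<in>topspace Y. \<tau> y \<in> topspace X \<and> 0 < \<alpha> y \<and> (\<forall>f\<in>C0_plus X. T f y = \<alpha> y * f (\<tau> y))" ..
  then have rep: "\<And>y. y \<in> topspace Y \<Longrightarrow> \<tau> y \<in> topspace X"
      "\<And>y. y \<in> topspace Y \<Longrightarrow> 0 < \<alpha> y"
      "\<And>f y. f \<in> C0_plus X \<Longrightarrow> y \<in> topspace Y \<Longrightarrow> T f y = \<alpha> y * f (\<tau> y)"
    by simp_all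
  have "\<alpha> y \<le> M" if y: "y \<in> topspace Y" for y
  proof -
    \<comment> \<open>Testing on \<open>f \<le> 1\<close> with value 1 at \<open>\<tau> y\<close>
      gives \<open>T f y = \<alpha> y\<close>, so the bound \<open>M\<close> passes to
      \<open>\<alpha>\<close>.\<close>
    obtain f where f: "f \<in> C0_plus X" "f (\<tau> y) = 1" "\<forall>z\<in>topspace X. f z \<le> 1"
      using C0_plus_Urysohn[OF X openin_topspace rep(1)[OF y]] by blast
    then show ?thesis using M(2)[OF f(1) _ y] rep(3)[OF f(1) y] by simp
  qed
  then show ?thesis using that[OF M(1)] rep by blast
qed

text \<open>Continuity is read off from the functions \<open>T f\<close>: cozero sets of Urysohn
  images give open neighborhoods inside preimages under \<open>\<tau>\<close>, and
  \<open>\<alpha>\<close> is locally a quotient of continuous functions.\<close>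

lemma weighted_composition_continuous:
  assumes X: "locally_compact_space X" "Hausdorff_space X"
    and T: "\<And>f. f \<in> C0_plus X \<Longrightarrow> T f \<in> C0_plus Y"
    and \<tau>: "\<And>y. y \<in> topspace Y \<Longrightarrow> \<tau> y \<in> topspace X" and \<alpha>: "\<And>y. y \<in> topspace Y \<Longrightarrow> 0 < \<alpha> y"
    and rep: "\<And>f y. f \<in> C0_plus X \<Longrightarrow> y \<in> topspace Y \<Longrightarrow> T f y = \<alpha> y * f (\<tau> y)"
  shows "continuous_map Y X \<tau>" "continuous_map Y euclideanreal \<alpha>"
proof -
  \<comment> \<open>Since \<open>\<alpha>\<close> is positive, this is also the set where
    \<open>f (\<tau> y) > 0\<close>; defining it through \<open>T f\<close> makes it open before
    \<open>\<tau>\<close> is known to be continuous.\<close>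
  define coz where "coz f = {y \<in> topspace Y. 0 < T f y}" for f
  have coz_open: "openin Y (coz f)" if "f \<in> C0_plus X" for f
    using C0_plusD(2)[OF T[OF that]] unfolding coz_def continuous_map_upper_lower_semicontinuous_lt
    by blast
  have coz_iff: "y \<in> coz f \<longleftrightarrow> 0 < f (\<tau> y)" if "f \<in> C0_plus X" "y \<in> topspace Y" for f y
    using that \<alpha>[OF that(2)] by (simp add: coz_def rep zero_less_mult_iff)
  show \<tau>_cont: "continuous_map Y X \<tau>"
    unfolding continuous_map_def
  proof (intro conjI allI impI)
    show "\<tau> \<in> topspace Y \<rightarrow> topspace X" using \<tau> by blast
    fix U assume U: "openin X U"
    show "openin Y {y \<in> topspace Y. \<tau> y \<in> U}"
    proof (subst openin_subopen, safe)
      fix y assume y: "y \<in> topspace Y" "\<tau> y \<in> U"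
      obtain f where f: "f \<in> C0_plus X" "f (\<tau> y) = 1" "\<forall>z\<in>topspace X - U. f z = 0"
        using C0_plus_Urysohn[OF X U y(2)] by blast
      have "y \<in> coz f" using coz_iff[OF f(1) y(1)] f(2) by simp
      moreover have "coz f \<subseteq> {y \<in> topspace Y. \<tau> y \<in> U}"
      proof
        fix z assume z: "z \<in> coz f"
        then have zY: "z \<in> topspace Y" by (simp add: coz_def)
        then have "f (\<tau> z) \<noteq> 0" using z coz_iff[OF f(1)] by simp
        then show "z \<in> {y \<in> topspace Y. \<tau> y \<in> U}" using f(3) \<tau>[OF zY] zY by blast
      qed
      ultimately show "\<exists>V. openin Y V \<and> y \<in> V \<and> V \<subseteq> {y \<in> topspace Y. \<tau> y \<in> U}"
        using coz_open[OF f(1)] by blast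
    qed
  qed
  have "\<exists>f. f \<in> C0_plus X \<and> f (\<tau> y) = 1" if "y \<in> topspace Y" for y
    using C0_plus_Urysohn[OF X openin_topspace \<tau>[OF that]] by blast
  then obtain p where p: "\<And>y. y \<in> topspace Y \<Longrightarrow> p y \<in> C0_plus X"
      "\<And>y. y \<in> topspace Y \<Longrightarrow> p y (\<tau> y) = 1"
    by metis
  have quot: "T (p i) y / p i (\<tau> y) = \<alpha> y" if "i \<in> topspace Y" "y \<in> coz (p i)" for i y
  proof -
    have "y \<in> topspace Y" using that(2) by (simp add: coz_def)
    then show ?thesis using coz_iff[OF p(1)] that rep[OF p(1)] by simp
  qed
  show "continuous_map Y euclideanreal \<alpha>"
  \<comment> \<open>The open sets \<open>coz (p i)\<close> cover \<open>Y\<close>, and on each of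
    them the quotient equals \<open>\<alpha>\<close>, so the pieces agree on overlaps.\<close>
  proof (rule pasting_lemma[where I = "topspace Y" and T = "\<lambda>i. coz (p i)"
        and f = "\<lambda>i y. T (p i) y / p i (\<tau> y)"])
    fix i assume i: "i \<in> topspace Y"
    show "openin Y (coz (p i))" by (rule coz_open[OF p(1)[OF i]])
    have "continuous_map Y euclideanreal (\<lambda>y. p i (\<tau> y))"
      using continuous_map_compose[OF \<tau>_cont C0_plusD(2)[OF p(1)[OF i]]] by (simp add: o_def)
    moreover have "continuous_map Y euclideanreal (T (p i))"
      by (rule C0_plusD(2)[OF T[OF p(1)[OF i]]])
    moreover have "p i (\<tau> y) \<noteq> 0" if "y \<in> topspace (subtopology Y (coz (p i)))" for y
      using that coz_iff[OF p(1)[OF i], of y] by auto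
    ultimately show "continuous_map (subtopology Y (coz (p i))) euclideanreal
        (\<lambda>y. T (p i) y / p i (\<tau> y))"
      by (intro continuous_map_real_divide continuous_map_from_subtopology) auto
  next
    fix y assume y: "y \<in> topspace Y"
    then have "y \<in> coz (p y)" using coz_iff[OF p(1)] p(2) by simp
    then show "\<exists>j. j \<in> topspace Y \<and> y \<in> coz (p j) \<and> \<alpha> y = T (p j) y / p j (\<tau> y)"
      using quot[OF y] y by metis
  qed (simp add: quot)
qed

text \<open>A function with value 1 at \<open>x\<close> and 0 at \<open>z\<close> would force
  \<open>a = 0\<close>, so the points agree; a function with value 1 there then compares the
  factors. This serves both to invert \<open>\<tau>\<close> and to prove uniqueness.\<close>

lemma weighted_composition_cancel:
  assumes X: "locally_compact_space X" "Hausdorff_space X"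
    and x: "x \<in> topspace X" "z \<in> topspace X" and "0 < (a::real)"
    and eq: "\<And>f. f \<in> C0_plus X \<Longrightarrow> a * f x = b * f z"
  shows "z = x" "b = a"
proof -
  show "z = x"
  proof (rule ccontr)
    assume "z \<noteq> x"
    then obtain f where "f \<in> C0_plus X" "f x = 1" "f z = 0"
      using C0_plus_separates[OF X x] by blast
    then show False using eq[of f] \<open>0 < a\<close> by simp
  qed
  obtain f where "f \<in> C0_plus X" "f x = 1"
    using C0_plus_Urysohn[OF X openin_topspace x(1)] by blast
  then show "b = a" using eq[of f] \<open>z = x\<close> by simp
qed

section \<open>Weighted composition operators: the converse direction\<close>

text \<open>Superlevel sets of the composition with \<open>\<tau>\<close> lie in images under the
  continuous inverse \<open>\<sigma>\<close> of compact ones; multiplying by the bounded weight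
  \<open>\<alpha>\<close> is then a case of domination.\<close>

lemma weighted_composition_in_C0_plus:
  assumes f: "f \<in> C0_plus X" and hom: "homeomorphic_maps Y X \<tau> \<sigma>"
    and \<alpha>: "continuous_map Y euclideanreal \<alpha>" "\<And>y. y \<in> topspace Y \<Longrightarrow> 0 \<le> \<alpha> y"
      "\<And>y. y \<in> topspace Y \<Longrightarrow> \<alpha> y \<le> B" "0 < B"
  shows "(\<lambda>y\<in>topspace Y. \<alpha> y * f (\<tau> y)) \<in> C0_plus Y"
proof -
  have \<tau>: "continuous_map Y X \<tau>" and \<sigma>: "continuous_map X Y \<sigma>"
    and \<sigma>\<tau>: "\<And>y. y \<in> topspace Y \<Longrightarrow> \<sigma> (\<tau> y) = y"
    using hom by (auto simp: homeomorphic_maps_def)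
  have \<tau>X: "\<tau> y \<in> topspace X" if "y \<in> topspace Y" for y
    using \<tau> that by (auto simp: continuous_map_def)
  have f\<tau>: "continuous_map Y euclideanreal (\<lambda>y. f (\<tau> y))"
    using continuous_map_compose[OF \<tau> C0_plusD(2)[OF f]] by (simp add: o_def)
  have "(\<lambda>y\<in>topspace Y. f (\<tau> y)) \<in> C0_plus Y"
  proof (rule C0_plus_restrictI[OF f\<tau>])
    show "0 \<le> f (\<tau> y)" if "y \<in> topspace Y" for y
      by (rule C0_plusD(3)[OF f \<tau>X[OF that]])
    fix \<epsilon> :: real assume "0 < \<epsilon>"
    then have "compactin Y (\<sigma> ` {x \<in> topspace X. \<epsilon> \<le> f x})"
      by (rule image_compactin[OF C0_plusD(4)[OF f] \<sigma>])
    moreover have "{y \<in> topspace Y. \<epsilon> \<le> f (\<tau> y)} \<subseteq> \<sigma> ` {x \<in> topspace X. \<epsilon> \<le> f x}"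
    proof
      fix y assume "y \<in> {y \<in> topspace Y. \<epsilon> \<le> f (\<tau> y)}"
      then show "y \<in> \<sigma> ` {x \<in> topspace X. \<epsilon> \<le> f x}"
        by (intro image_eqI[of _ _ "\<tau> y"]) (simp_all add: \<sigma>\<tau> \<tau>X)
    qed
    ultimately show "\<exists>K. compactin Y K \<and> {y \<in> topspace Y. \<epsilon> \<le> f (\<tau> y)} \<subseteq> K" by blast
  qed
  then show ?thesis
  proof (rule C0_plus_restrict_dominated[OF _ _ \<open>0 < B\<close>])
    show "continuous_map Y euclideanreal (\<lambda>y. \<alpha> y * f (\<tau> y))"
      by (rule continuous_map_real_mult[OF \<alpha>(1) f\<tau>])
    fix y assume y: "y \<in> topspace Y"
    have "0 \<le> f (\<tau> y)" by (rule C0_plusD(3)[OF f \<tau>X[OF y]])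
    then show "0 \<le> \<alpha> y * f (\<tau> y)" "\<alpha> y * f (\<tau> y) \<le> B * (\<lambda>y\<in>topspace Y. f (\<tau> y)) y"
      using \<alpha>(2,3)[OF y] y by (simp_all add: mult_right_mono)
  qed
qed

lemma weighted_composition_order_isomorphism:
  assumes "0 < \<delta>" and \<alpha>: "\<alpha> \<in> topspace Y \<rightarrow> {\<delta>..}" "continuous_map Y euclideanreal \<alpha>"
      "bounded (\<alpha> ` topspace Y)"
    and \<tau>: "homeomorphic_map Y X \<tau>"
  shows "order_isomorphism X Y (\<lambda>f. \<lambda>y\<in>topspace Y. \<alpha> y * f (\<tau> y))" (is "order_isomorphism X Y ?T")
    and "positive_homogeneous X Y (\<lambda>f. \<lambda>y\<in>topspace Y. \<alpha> y * f (\<tau> y))"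
proof -
  obtain \<sigma> where hom: "homeomorphic_maps Y X \<tau> \<sigma>" using \<tau> by (auto simp: homeomorphic_map_maps)
  then have hom': "homeomorphic_maps X Y \<sigma> \<tau>" by (rule homeomorphic_maps_sym[THEN iffD1])
  have \<tau>_cont: "continuous_map Y X \<tau>" and \<sigma>_cont: "continuous_map X Y \<sigma>"
    and \<sigma>\<tau>: "\<And>y. y \<in> topspace Y \<Longrightarrow> \<sigma> (\<tau> y) = y" and \<tau>\<sigma>: "\<And>x. x \<in> topspace X \<Longrightarrow> \<tau> (\<sigma> x) = x"
    using hom by (auto simp: homeomorphic_maps_def)
  have \<tau>X: "\<tau> y \<in> topspace X" if "y \<in> topspace Y" for y
    using \<tau>_cont that by (auto simp: continuous_map_def)
  have \<sigma>Y: "\<sigma> x \<in> topspace Y" if "x \<in> topspace X" for x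
    using \<sigma>_cont that by (auto simp: continuous_map_def)
  obtain B where "\<forall>y\<in>topspace Y. \<bar>\<alpha> y\<bar> \<le> B"
    using \<alpha>(3) by (auto simp: bounded_iff)
  \<comment> \<open>Taking the maximum with 1 keeps the bound positive even when \<open>Y\<close> is
    empty and \<open>B\<close> is arbitrary.\<close>
  then have B: "\<alpha> y \<le> max B 1" if "y \<in> topspace Y" for y using that by fastforce
  have \<delta>: "\<delta> \<le> \<alpha> y" if "y \<in> topspace Y" for y using \<alpha>(1) that by auto
  then have pos: "0 < \<alpha> y" if "y \<in> topspace Y" for y using that \<open>0 < \<delta>\<close> by fastforce
  \<comment> \<open>The inverse operator is again a weighted composition; the lower bound
    \<open>\<delta>\<close> of \<open>\<alpha>\<close> bounds its weight by
    \<open>1 / \<delta>\<close>.\<close>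
  let ?S = "\<lambda>g. \<lambda>x\<in>topspace X. 1 / \<alpha> (\<sigma> x) * g (\<sigma> x)"
  have T_in: "?T f \<in> C0_plus Y" if "f \<in> C0_plus X" for f
    by (rule weighted_composition_in_C0_plus[OF that hom \<alpha>(2), of "max B 1"])
      (use pos B in \<open>auto intro: less_imp_le\<close>)
  have \<alpha>\<sigma>: "continuous_map X euclideanreal (\<lambda>x. \<alpha> (\<sigma> x))"
    using continuous_map_compose[OF \<sigma>_cont \<alpha>(2)] by (simp add: o_def)
  have S_in: "?S g \<in> C0_plus X" if "g \<in> C0_plus Y" for g
  proof (rule weighted_composition_in_C0_plus[OF that hom', of _ "1 / \<delta>"])
    show "continuous_map X euclideanreal (\<lambda>x. 1 / \<alpha> (\<sigma> x))"
      by (rule continuous_map_real_divide[OF _ \<alpha>\<sigma>]) (use pos[OF \<sigma>Y] in force)+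
    fix x assume "x \<in> topspace X"
    then show "0 \<le> 1 / \<alpha> (\<sigma> x)" "1 / \<alpha> (\<sigma> x) \<le> 1 / \<delta>"
      using pos[OF \<sigma>Y] \<delta>[OF \<sigma>Y] \<open>0 < \<delta>\<close> by (simp_all add: less_imp_le frac_le)
  qed (use \<open>0 < \<delta>\<close> in simp)
  have "bij_betw ?T (C0_plus X) (C0_plus Y)"
  proof (rule bij_betw_byWitness[where f' = ?S])
    show "\<forall>f\<in>C0_plus X. ?S (?T f) = f"
    proof
      fix f assume f: "f \<in> C0_plus X"
      show "?S (?T f) = f"
      proof (rule C0_plus_eqI[OF S_in[OF T_in[OF f]] f])
        fix x assume "x \<in> topspace X"
        then show "?S (?T f) x = f x" using pos[OF \<sigma>Y, of x] by (simp add: \<sigma>Y \<tau>\<sigma>)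
      qed
    qed
    show "\<forall>g\<in>C0_plus Y. ?T (?S g) = g"
    proof
      fix g assume g: "g \<in> C0_plus Y"
      show "?T (?S g) = g"
      proof (rule C0_plus_eqI[OF T_in[OF S_in[OF g]] g])
        fix y assume "y \<in> topspace Y"
        then show "?T (?S g) y = g y" using pos[of y] by (simp add: \<tau>X \<sigma>\<tau>)
      qed
    qed
  qed (use T_in S_in in blast)+
  moreover have "le_on X f g \<longleftrightarrow> le_on Y (?T f) (?T g)" for f g
  proof
    assume "le_on X f g"
    then show "le_on Y (?T f) (?T g)"
      unfolding le_on_def using \<tau>X pos by (simp add: less_imp_le mult_left_mono)
  next
    assume *: "le_on Y (?T f) (?T g)"
    show "le_on X f g"
      unfolding le_on_def
    proof
      fix x assume x: "x \<in> topspace X"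
      then have "\<alpha> (\<sigma> x) * f x \<le> \<alpha> (\<sigma> x) * g x"
        using *[unfolded le_on_def, rule_format, OF \<sigma>Y[OF x]] by (simp add: \<sigma>Y \<tau>\<sigma>)
      then show "f x \<le> g x" using pos[OF \<sigma>Y[OF x]] by simp
    qed
  qed
  ultimately show "order_isomorphism X Y ?T" by (simp add: order_isomorphism_def)
  show "positive_homogeneous X Y ?T"
    unfolding positive_homogeneous_def scale_on_def by (auto simp: \<tau>X restrict_def fun_eq_iff)
qed

section \<open>Assembling the representation and proving uniqueness\<close>

text \<open>Both \<open>T\<close> and its inverse have pointwise representations. Their two
  compositions are identities, and comparing these with weighted compositions shows that
  \<open>\<tau>\<close> and \<open>\<sigma>\<close> are mutually inverse and the weights
  reciprocal.\<close>

lemma order_isomorphism_representation: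
  assumes X: "locally_compact_space X" "Hausdorff_space X"
    and Y: "locally_compact_space Y" "Hausdorff_space Y"
    and T: "order_isomorphism X Y T" and hom: "positive_homogeneous X Y T"
  obtains \<delta> :: real and \<alpha> \<tau> where "0 < \<delta>" "\<alpha> \<in> topspace Y \<rightarrow> {\<delta>..}"
    "continuous_map Y euclideanreal \<alpha>" "bounded (\<alpha> ` topspace Y)" "homeomorphic_map Y X \<tau>"
    "\<And>f y. f \<in> C0_plus X \<Longrightarrow> y \<in> topspace Y \<Longrightarrow> T f y = \<alpha> y * f (\<tau> y)"
proof -
  let ?S = "inv_into (C0_plus X) T"
  note S = order_isomorphism_inv_into[OF T]
  have bij: "bij_betw T (C0_plus X) (C0_plus Y)" using T by (simp add: order_isomorphism_def)
  obtain M \<alpha> \<tau> where M: "0 < M" and \<tau>: "\<And>y. y \<in> topspace Y \<Longrightarrow> \<tau> y \<in> topspace X"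
    and \<alpha>: "\<And>y. y \<in> topspace Y \<Longrightarrow> 0 < \<alpha> y" "\<And>y. y \<in> topspace Y \<Longrightarrow> \<alpha> y \<le> M"
    and T_rep: "\<And>f y. f \<in> C0_plus X \<Longrightarrow> y \<in> topspace Y \<Longrightarrow> T f y = \<alpha> y * f (\<tau> y)"
    using order_isomorphism_pointwise[OF X Y T hom] by metis
  obtain N \<beta> \<sigma> where N: "0 < N" and \<sigma>: "\<And>x. x \<in> topspace X \<Longrightarrow> \<sigma> x \<in> topspace Y"
    and \<beta>: "\<And>x. x \<in> topspace X \<Longrightarrow> 0 < \<beta> x" "\<And>x. x \<in> topspace X \<Longrightarrow> \<beta> x \<le> N"
    and S_rep: "\<And>g x. g \<in> C0_plus Y \<Longrightarrow> x \<in> topspace X \<Longrightarrow> ?S g x = \<beta> x * g (\<sigma> x)"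
    using order_isomorphism_pointwise[OF Y X S positive_homogeneous_inv_into[OF T hom]] by metis
  have \<tau>\<sigma>: "\<tau> (\<sigma> x) = x" if x: "x \<in> topspace X" for x
  proof (rule weighted_composition_cancel(1)[OF X x \<tau>[OF \<sigma>[OF x]] zero_less_one])
    fix f assume f: "f \<in> C0_plus X"
    have "f x = ?S (T f) x" by (simp add: bij_betw_inv_into_left[OF bij f])
    then show "1 * f x = \<beta> x * \<alpha> (\<sigma> x) * f (\<tau> (\<sigma> x))"
      by (simp add: S_rep[OF order_isomorphism_in[OF T f] x] T_rep[OF f \<sigma>[OF x]])
  qed
  have cancel: "\<sigma> (\<tau> y) = y" "\<alpha> y * \<beta> (\<tau> y) = 1" if y: "y \<in> topspace Y" for y
  proof -
    have eq: "1 * g y = \<alpha> y * \<beta> (\<tau> y) * g (\<sigma> (\<tau> y))" if g: "g \<in> C0_plus Y" for g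
    proof -
      have "g y = T (?S g) y" by (simp add: bij_betw_inv_into_right[OF bij g])
      then show ?thesis
        by (simp add: T_rep[OF order_isomorphism_in[OF S g] y] S_rep[OF g \<tau>[OF y]])
    qed
    show "\<sigma> (\<tau> y) = y" "\<alpha> y * \<beta> (\<tau> y) = 1"
      by (rule weighted_composition_cancel[OF Y y \<sigma>[OF \<tau>[OF y]] zero_less_one eq], assumption)+
  qed
  show ?thesis
  \<comment> \<open>From \<open>\<alpha> y * \<beta> (\<tau> y) = 1\<close> and
    \<open>\<beta> \<le> N\<close> comes the lower bound \<open>1 / N\<close> for
    \<open>\<alpha>\<close>.\<close>
  proof (rule that[of "1 / N" \<alpha> \<tau>])
    show "\<alpha> \<in> topspace Y \<rightarrow> {1 / N..}"
    proof
      fix y assume y: "y \<in> topspace Y"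
      have "1 \<le> \<alpha> y * N"
        using mult_left_mono[OF \<beta>(2)[OF \<tau>[OF y]], of "\<alpha> y"] cancel(2)[OF y] \<alpha>(1)[OF y] by simp
      then show "\<alpha> y \<in> {1 / N..}" using N by (simp add: divide_le_eq)
    qed
    show "bounded (\<alpha> ` topspace Y)"
      unfolding bounded_iff by (rule exI[of _ M]) (use \<alpha> in \<open>force simp: abs_of_pos\<close>)
    have "continuous_map Y X \<tau>"
      by (rule weighted_composition_continuous(1)[OF X, of T Y \<tau> \<alpha>])
        (fact order_isomorphism_in[OF T] \<tau> \<alpha>(1) T_rep)+
    moreover have "continuous_map X Y \<sigma>"
      by (rule weighted_composition_continuous(1)[OF Y, of ?S X \<sigma> \<beta>])
        (fact order_isomorphism_in[OF S] \<sigma> \<beta>(1) S_rep)+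
    ultimately have "homeomorphic_maps Y X \<tau> \<sigma>"
      using \<tau>\<sigma> cancel(1) by (simp add: homeomorphic_maps_def)
    then show "homeomorphic_map Y X \<tau>" by (rule homeomorphic_maps_imp_map)
    show "continuous_map Y euclideanreal \<alpha>"
      by (rule weighted_composition_continuous(2)[OF X, of T Y \<tau> \<alpha>])
        (fact order_isomorphism_in[OF T] \<tau> \<alpha>(1) T_rep)+
  qed (use N T_rep in simp_all)
qed

text \<open>Uniqueness is stated for the pair \<open>(\<alpha>, \<tau>)\<close>. Extensional
  function spaces make it equality of functions on \<open>Y\<close>, independent of values outside
  \<open>topspace Y\<close>.\<close>

theorem theorem1p1:
  fixes X :: "'a topology" and Y :: "'b topology"
  assumes "locally_compact_space X" and "Hausdorff_space X"
    and "locally_compact_space Y" and "Hausdorff_space Y"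
  shows
    "(\<forall>T. order_isomorphism X Y T \<and> positive_homogeneous X Y T \<longrightarrow>
        (\<exists>\<delta>>0. \<exists>!p. case p of (\<alpha>, \<tau>) \<Rightarrow>
            \<alpha> \<in> topspace Y \<rightarrow>\<^sub>E {\<delta>..} \<and> continuous_map Y euclideanreal \<alpha> \<and> bounded (\<alpha> ` topspace Y) \<and>
            \<tau> \<in> topspace Y \<rightarrow>\<^sub>E topspace X \<and> homeomorphic_map Y X \<tau> \<and>
            (\<forall>f \<in> C0_plus X. \<forall>y \<in> topspace Y. T f y = \<alpha> y * f (\<tau> y))))
     \<and>
     (\<forall>(\<delta>::real) \<alpha> \<tau>.
        \<delta> > 0 \<and>
        \<alpha> \<in> topspace Y \<rightarrow>\<^sub>E {\<delta>..} \<and> continuous_map Y euclideanreal \<alpha> \<and> bounded (\<alpha> ` topspace Y) \<and>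
        \<tau> \<in> topspace Y \<rightarrow>\<^sub>E topspace X \<and> homeomorphic_map Y X \<tau> \<longrightarrow>
        order_isomorphism X Y (\<lambda>f. \<lambda>y \<in> topspace Y. \<alpha> y * f (\<tau> y)) \<and>
        positive_homogeneous X Y (\<lambda>f. \<lambda>y \<in> topspace Y. \<alpha> y * f (\<tau> y)))"
proof (intro conjI allI impI; (elim conjE)?)
  fix T assume T: "order_isomorphism X Y T" and hom: "positive_homogeneous X Y T"
  obtain \<delta> \<alpha> \<tau> where "0 < \<delta>" and \<alpha>: "\<alpha> \<in> topspace Y \<rightarrow> {\<delta>..}"
    "continuous_map Y euclideanreal \<alpha>" "bounded (\<alpha> ` topspace Y)" and \<tau>: "homeomorphic_map Y X \<tau>"
    and rep: "\<And>f y. f \<in> C0_plus X \<Longrightarrow> y \<in> topspace Y \<Longrightarrow> T f y = \<alpha> y * f (\<tau> y)"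
    by (rule order_isomorphism_representation[OF assms T hom]) blast
  have \<tau>X: "\<tau> y \<in> topspace X" if "y \<in> topspace Y" for y
    using homeomorphic_imp_surjective_map[OF \<tau>] that by auto
  \<comment> \<open>The restrictions are the extensional representatives of the
    \<open>\<alpha>\<close> and \<open>\<tau>\<close> just obtained.\<close>
  let ?\<alpha> = "restrict \<alpha> (topspace Y)" and ?\<tau> = "restrict \<tau> (topspace Y)"
  show "\<exists>\<delta>>0. \<exists>!p. case p of (\<alpha>, \<tau>) \<Rightarrow>
      \<alpha> \<in> topspace Y \<rightarrow>\<^sub>E {\<delta>..} \<and> continuous_map Y euclideanreal \<alpha> \<and> bounded (\<alpha> ` topspace Y) \<and>
      \<tau> \<in> topspace Y \<rightarrow>\<^sub>E topspace X \<and> homeomorphic_map Y X \<tau> \<and>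
      (\<forall>f \<in> C0_plus X. \<forall>y \<in> topspace Y. T f y = \<alpha> y * f (\<tau> y))"
  proof (intro exI[of _ \<delta>] conjI ex1I[of _ "(?\<alpha>, ?\<tau>)"])
    have "continuous_map Y euclideanreal ?\<alpha>" using \<alpha>(2) by (rule continuous_map_eq) simp
    moreover have "homeomorphic_map Y X ?\<tau>" using \<tau> by (rule homeomorphic_map_eq) simp
    moreover have "?\<alpha> \<in> topspace Y \<rightarrow>\<^sub>E {\<delta>..}" "?\<tau> \<in> topspace Y \<rightarrow>\<^sub>E topspace X"
      using \<alpha>(1) \<tau>X by auto
    moreover have "bounded (?\<alpha> ` topspace Y)" using \<alpha>(3) by simp
    ultimately show "case (?\<alpha>, ?\<tau>) of (\<alpha>, \<tau>) \<Rightarrow>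
        \<alpha> \<in> topspace Y \<rightarrow>\<^sub>E {\<delta>..} \<and> continuous_map Y euclideanreal \<alpha> \<and> bounded (\<alpha> ` topspace Y) \<and>
        \<tau> \<in> topspace Y \<rightarrow>\<^sub>E topspace X \<and> homeomorphic_map Y X \<tau> \<and>
        (\<forall>f \<in> C0_plus X. \<forall>y \<in> topspace Y. T f y = \<alpha> y * f (\<tau> y))"
      using rep by simp
  next
    fix p assume "case p of (\<alpha>, \<tau>) \<Rightarrow>
        \<alpha> \<in> topspace Y \<rightarrow>\<^sub>E {\<delta>..} \<and> continuous_map Y euclideanreal \<alpha> \<and> bounded (\<alpha> ` topspace Y) \<and>
        \<tau> \<in> topspace Y \<rightarrow>\<^sub>E topspace X \<and> homeomorphic_map Y X \<tau> \<and>
        (\<forall>f \<in> C0_plus X. \<forall>y \<in> topspace Y. T f y = \<alpha> y * f (\<tau> y))"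
    then obtain \<alpha>' \<tau>' where p: "p = (\<alpha>', \<tau>')" and \<alpha>': "\<alpha>' \<in> topspace Y \<rightarrow>\<^sub>E {\<delta>..}"
      and \<tau>': "\<tau>' \<in> topspace Y \<rightarrow>\<^sub>E topspace X"
      and rep': "\<forall>f \<in> C0_plus X. \<forall>y \<in> topspace Y. T f y = \<alpha>' y * f (\<tau>' y)"
      by (cases p) simp
    \<comment> \<open>At each \<open>y\<close> both pairs represent the same functional, so
      cancellation identifies the points and the factors.\<close>
    have eq: "\<tau>' y = \<tau> y" "\<alpha>' y = \<alpha> y" if y: "y \<in> topspace Y" for y
    proof -
      have "0 < \<alpha> y" using funcset_mem[OF \<alpha>(1) y] \<open>0 < \<delta>\<close> by simp
      moreover have "\<tau>' y \<in> topspace X" using \<tau>' y by auto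
      moreover have "\<alpha> y * f (\<tau> y) = \<alpha>' y * f (\<tau>' y)" if f: "f \<in> C0_plus X" for f
        using rep[OF f y] rep' f y by simp
      ultimately show "\<tau>' y = \<tau> y" "\<alpha>' y = \<alpha> y"
        using weighted_composition_cancel[OF assms(1,2) \<tau>X[OF y]] by blast+
    qed
    have "\<alpha>' = ?\<alpha>"
      by (rule extensionalityI[of _ "topspace Y"]) (use \<alpha>' eq(2) in \<open>simp_all add: PiE_def\<close>)
    moreover have "\<tau>' = ?\<tau>"
      by (rule extensionalityI[of _ "topspace Y"]) (use \<tau>' eq(1) in \<open>simp_all add: PiE_def\<close>)
    ultimately show "p = (?\<alpha>, ?\<tau>)" using p by simp
  qed (use \<open>0 < \<delta>\<close> in simp)
next
  fix \<delta> :: real and \<alpha> \<tau>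
  assume "0 < \<delta>" "\<alpha> \<in> topspace Y \<rightarrow>\<^sub>E {\<delta>..}" "continuous_map Y euclideanreal \<alpha>"
    "bounded (\<alpha> ` topspace Y)" "homeomorphic_map Y X \<tau>"
  then show "order_isomorphism X Y (\<lambda>f. \<lambda>y \<in> topspace Y. \<alpha> y * f (\<tau> y))"
    "positive_homogeneous X Y (\<lambda>f. \<lambda>y \<in> topspace Y. \<alpha> y * f (\<tau> y))"
    using weighted_composition_order_isomorphism[of \<delta> \<alpha> Y X \<tau>] by (auto simp: PiE_def)
qed

end
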